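(* Let $\sigma=\sigma_1\cdots\sigma_k$ be a permutation of length $k\ge 3$. The following three conditions are equivalent. (1) $\mathrm{Sort}(\sigma)\not\subseteq\mathrm{Sym}(\xi)$. (2) $\sigma=12\ominus\beta$ for some $\beta\in\mathrm{Sym}(231)$. (3) $\hat{\sigma}\in\mathrm{Sym}(231)$ and $\sigma^{\mathsf{R}}$ contains $\xi$.
   Context: $\mathrm{Sym}_n$ is the set of permutations of $\{1,\dots,n\}$ in one-line notation and $\mathrm{Sym}=\bigcup_{n\ge 1}\mathrm{Sym}_n$. A sequence of distinct numbers contains a permutation $\tau$ of length $k$ if it has a (not necessarily contiguous) subsequence of length $k$ that is order isomorphic to $\tau$ (such a subsequence is an occurrence of $\tau$); otherwise it avoids $\tau$. $\mathrm{Sym}(\tau)$ denotes the set of permutations in $\mathrm{Sym}$ avoiding $\tau$. Bivincular pattern $\xi=(132,\{0,2\},\emptyset)$: a permutation $\pi=\pi_1\cdots\pi_n$ contains $\xi$ if there is an index $j\ge 2$ with $j+1\le n$ such that $\pi_1<\pi_{j+1}<\pi_j$ (that is, $\pi_1\pi_j\pi_{j+1}$ is an occurrence of $132$ that starts at the first entry of $\pi$ and whose last two entries are adjacent in position); otherwise $\pi$ avoids $\xi$. $\mathrm{Sym}(\xi)$ is the set of permutations avoiding $\xi$. For $\sigma=\sigma_1\sigma_2\sigma_3\cdots\sigma_k$: $\hat\sigma=\sigma_2\sigma_1\sigma_3\cdots\sigma_k$ (interchange the first two entries) and $\sigma^{\mathsf{R}}=\sigma_k\cdots\sigma_1$. The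 skew sum $\alpha\ominus\beta$ of permutations $\alpha$ (of length $n$) and $\beta$ (of length $m$) is the permutation $\gamma_1\cdots\gamma_{n+m}$ such that $\gamma_1\cdots\gamma_n$ is order isomorphic to $\alpha$, $\gamma_{n+1}\cdots\gamma_{n+m}$ is order isomorphic to $\beta$, and $\gamma_i>\gamma_j$ whenever $i\le n<j$. For a permutation $\tau$ of length at least two, the $\tau$-stack operator $\mathcal{S}^{\tau}:\mathrm{Sym}\to\mathrm{Sym}$ sends $\pi$ to the output of the following greedy process, starting with an empty stack and an empty output. While there are unread entries of $\pi$ (read from left to right): if pushing the next entry on top of the stack yields stack content that, read from top to bottom, avoids $\tau$, push it; otherwise pop the top entry of the stack and append it to the right end of the output. When all entries of $\pi$ have been read, pop all remaining entries of the stack one by one, appending them to the output. A permutation $\pi\in\mathrm{Sym}_n$ is $\sigma$-sortable if $(\mathcal{S}^{21}\circ\mathcal{S}^{\sigma})(\pi)=12\cdots n$; $\mathrm{Sort}(\sigma)$ is the set of $\sigma$-sortable permutations. *)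

theory Defs
  imports "HOL-Library.Sublist" "HOL-Combinatorics.Multiset_Permutations"
begin

text \<open>Permutations are lists of natural numbers in one-line notation, with values
  \<open>1, \<dots>, n\<close>; list positions are counted from \<open>0\<close>.\<close>

definition Sym_n :: "nat \<Rightarrow> nat list set" where
  "Sym_n n = permutations_of_set {1..n}"

definition Sym :: "nat list set" where
  "Sym = (\<Union>n\<in>{1..}. Sym_n n)"

definition order_iso :: "nat list \<Rightarrow> nat list \<Rightarrow> bool" where
  "order_iso xs ys \<longleftrightarrow> length xs = length ys \<and>
     (\<forall>i<length xs. \<forall>j<length xs. xs ! i < xs ! j \<longleftrightarrow> ys ! i < ys ! j)"

definition contains :: "nat list \<Rightarrow> nat list \<Rightarrow> bool" where
  "contains xs \<tau> \<longleftrightarrow> (\<exists>ys. subseq ys xs \<and> order_iso ys \<tau>)"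

abbreviation avoids :: "nat list \<Rightarrow> nat list \<Rightarrow> bool" where
  "avoids xs \<tau> \<equiv> \<not> contains xs \<tau>"

definition Sym_avoiding :: "nat list \<Rightarrow> nat list set" where
  "Sym_avoiding \<tau> = {\<pi> \<in> Sym. avoids \<pi> \<tau>}"

text \<open>The bivincular pattern \<open>\<xi> = (132, {0,2}, {})\<close>: an occurrence of \<open>132\<close> that starts at the
  first entry and whose last two entries are adjacent in position.\<close>

definition contains_xi :: "nat list \<Rightarrow> bool" where
  "contains_xi \<pi> \<longleftrightarrow>
     (\<exists>j\<ge>1. j + 1 < length \<pi> \<and> \<pi> ! 0 < \<pi> ! (j + 1) \<and> \<pi> ! (j + 1) < \<pi> ! j)"

definition Sym_avoiding_xi :: "nat list set" where
  "Sym_avoiding_xi = {\<pi> \<in> Sym. \<not> contains_xi \<pi>}"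

fun swap_first_two :: "nat list \<Rightarrow> nat list" where
  "swap_first_two (a # b # xs) = b # a # xs"
| "swap_first_two xs = xs"

definition skew_sum :: "nat list \<Rightarrow> nat list \<Rightarrow> nat list" (infixl "\<ominus>" 65) where
  "\<alpha> \<ominus> \<beta> = map (\<lambda>x. x + length \<beta>) \<alpha> @ \<beta>"

text \<open>\<open>stack_run \<tau> st xs\<close> is the output that the greedy process still produces from the state
  with stack content \<open>st\<close> (top entry first) and unread entries \<open>xs\<close>. An entry is always
  pushed onto an empty stack, which agrees with the greedy rule when \<open>\<tau>\<close> has length at
  least two, because a single entry then avoids \<open>\<tau>\<close>.\<close>

function stack_run :: "nat list \<Rightarrow> nat list \<Rightarrow> nat list \<Rightarrow> nat list" where
  "stack_run \<tau> st [] = st"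
| "stack_run \<tau> [] (x # xs) = stack_run \<tau> [x] xs"
| "stack_run \<tau> (y # st) (x # xs) =
     (if avoids (x # y # st) \<tau> then stack_run \<tau> (x # y # st) xs
      else y # stack_run \<tau> st (x # xs))"
  by pat_completeness auto
termination
  by (relation "measure (\<lambda>(\<tau>, st, xs). 2 * length xs + length st)") auto

definition stack_op :: "nat list \<Rightarrow> nat list \<Rightarrow> nat list" where
  "stack_op \<tau> \<pi> = stack_run \<tau> [] \<pi>"

definition Sort :: "nat list \<Rightarrow> nat list set" where
  "Sort \<sigma> = {\<pi> \<in> Sym. (stack_op [2, 1] \<circ> stack_op \<sigma>) \<pi> = [1..<length \<pi> + 1]}"

text \<open>The skew sum is the unique permutation with its defining order properties.\<close>

lemma order_iso_same_set_eq:
  assumes iso: "order_iso xs ys" and "distinct xs" "distinct ys" and sets: "set xs = set ys"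
  shows "xs = ys"
proof -
  have len: "length xs = length ys" using iso by (simp add: order_iso_def)
  have rank: "card {x \<in> set zs. x < zs ! i} = card {j. j < length zs \<and> zs ! j < zs ! i}"
    if "distinct zs" for zs :: "nat list" and i
  proof -
    have "{x \<in> set zs. x < zs ! i} = (!) zs ` {j. j < length zs \<and> zs ! j < zs ! i}"
      by (auto simp: in_set_conv_nth)
    moreover have "inj_on ((!) zs) {j. j < length zs \<and> zs ! j < zs ! i}"
      using that by (auto simp: inj_on_def nth_eq_iff_index_eq)
    ultimately show ?thesis by (simp add: card_image)
  qed
  have mono: "card {x \<in> S. x < a} < card {x \<in> S. x < b}" if "finite S" "a \<in> S" "a < b"
    for S :: "nat set" and a b
  proof (rule psubset_card_mono)
    show "finite {x \<in> S. x < b}" using that by simp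
    have "a \<in> {x \<in> S. x < b}" "a \<notin> {x \<in> S. x < a}" using that by simp_all
    moreover have "{x \<in> S. x < a} \<subseteq> {x \<in> S. x < b}"
      using less_trans[OF _ \<open>a < b\<close>] by blast
    ultimately show "{x \<in> S. x < a} \<subset> {x \<in> S. x < b}" by blast
  qed
  show ?thesis
  proof (rule nth_equalityI[OF len])
    fix i assume i: "i < length xs"
    have "xs ! j < xs ! i \<longleftrightarrow> ys ! j < ys ! i" if "j < length xs" for j
      using iso i that unfolding order_iso_def by blast
    then have "{j. j < length xs \<and> xs ! j < xs ! i} = {j. j < length ys \<and> ys ! j < ys ! i}"
      unfolding len[symmetric] by blast
    then have "card {x \<in> set xs. x < xs ! i} = card {x \<in> set ys. x < ys ! i}"
      by (simp only: rank[OF assms(2)] rank[OF assms(3)])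
    then have c: "card {x \<in> set xs. x < xs ! i} = card {x \<in> set xs. x < ys ! i}"
      by (simp only: sets)
    have m: "xs ! i \<in> set xs" "ys ! i \<in> set xs"
      using i len sets nth_mem[of i xs] nth_mem[of i ys] by simp_all
    have "\<not> xs ! i < ys ! i"
      using mono[OF finite_set m(1), of "ys ! i"] c by linarith
    moreover have "\<not> ys ! i < xs ! i"
      using mono[OF finite_set m(2), of "xs ! i"] c by linarith
    ultimately show "xs ! i = ys ! i" by linarith
  qed
qed

lemma skew_sum_eq_iff:
  assumes \<alpha>: "\<alpha> \<in> Sym_n n" and \<beta>: "\<beta> \<in> Sym_n m"
  shows "\<gamma> = \<alpha> \<ominus> \<beta> \<longleftrightarrow>
    \<gamma> \<in> Sym_n (n + m) \<and> order_iso (take n \<gamma>) \<alpha> \<and> order_iso (drop n \<gamma>) \<beta> \<and>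
    (\<forall>i j. i < n \<and> n \<le> j \<and> j < n + m \<longrightarrow> \<gamma> ! i > \<gamma> ! j)"
    (is "_ \<longleftrightarrow> ?P \<gamma>")
proof -
  have len: "length \<alpha> = n" "length \<beta> = m"
    and d: "distinct \<alpha>" "distinct \<beta>" and s: "set \<alpha> = {1..n}" "set \<beta> = {1..m}"
    using \<alpha> \<beta> by (auto simp: Sym_n_def permutations_of_set_def dest: distinct_card)
  have im: "(\<lambda>x. x + m) ` {1..n} = {1 + m..n + m}"
    by (simp only: image_add_atLeastAtMost')
  have P: "?P (\<alpha> \<ominus> \<beta>)"
  proof (intro conjI allI impI)
    have "distinct (\<alpha> \<ominus> \<beta>)"
      using d s im by (auto simp: skew_sum_def len distinct_map)
    moreover have "set (\<alpha> \<ominus> \<beta>) = {1..n + m}"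
      unfolding skew_sum_def using s im by (auto simp: len)
    ultimately show "\<alpha> \<ominus> \<beta> \<in> Sym_n (n + m)"
      by (simp add: Sym_n_def permutations_of_set_def)
    show "order_iso (take n (\<alpha> \<ominus> \<beta>)) \<alpha>" "order_iso (drop n (\<alpha> \<ominus> \<beta>)) \<beta>"
      by (auto simp: skew_sum_def order_iso_def len)
    fix i j assume ij: "i < n \<and> n \<le> j \<and> j < n + m"
    then have "\<alpha> ! i \<in> set \<alpha>" "\<beta> ! (j - n) \<in> set \<beta>"
      using len by (auto intro!: nth_mem)
    then have "\<alpha> ! i \<in> {1..n}" "\<beta> ! (j - n) \<in> {1..m}"
      by (simp_all only: s)
    then show "(\<alpha> \<ominus> \<beta>) ! i > (\<alpha> \<ominus> \<beta>) ! j"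
      using ij by (auto simp: skew_sum_def nth_append len)
  qed
  have uniq: "\<gamma> = \<delta>" if \<gamma>: "?P \<gamma>" and \<delta>: "?P \<delta>" for \<gamma> \<delta>
  proof (rule order_iso_same_set_eq)
    show "distinct \<gamma>" "distinct \<delta>" "set \<gamma> = set \<delta>"
      using \<gamma> \<delta> by (auto simp: Sym_n_def permutations_of_set_def)
    have l: "length \<gamma> = n + m" "length \<delta> = n + m"
      using \<gamma> \<delta> by (auto simp: Sym_n_def permutations_of_set_def dest: distinct_card)
    have lo: "\<gamma> ! i < \<gamma> ! j \<longleftrightarrow> \<delta> ! i < \<delta> ! j" if "i < n" "j < n" for i j
      using \<gamma> \<delta> that l len by (simp add: order_iso_def)
    have hi: "\<gamma> ! i < \<gamma> ! j \<longleftrightarrow> \<delta> ! i < \<delta> ! j"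
      if ij: "n \<le> i" "i < n + m" "n \<le> j" "j < n + m" for i j
    proof -
      obtain i' j' where "i = n + i'" "j = n + j'"
        using ij by (auto simp: le_iff_add)
      moreover from this have "i' < m" "j' < m" using ij by auto
      ultimately
      show ?thesis using \<gamma> \<delta> l len by (simp add: order_iso_def)
    qed
    have cr: "\<gamma> ! j < \<gamma> ! i" "\<delta> ! j < \<delta> ! i" if "i < n" "n \<le> j" "j < n + m" for i j
      using \<gamma> \<delta> that by blast+
    show "order_iso \<gamma> \<delta>"
      unfolding order_iso_def
    proof (intro conjI allI impI)
      fix i j assume "i < length \<gamma>" "j < length \<gamma>"
      then show "\<gamma> ! i < \<gamma> ! j \<longleftrightarrow> \<delta> ! i < \<delta> ! j"
        using lo[of i j] hi[of i j] cr[of i j] cr[of j i] l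
        by (cases "i < n"; cases "j < n") auto
    qed (simp add: l)
  qed
  show ?thesis using P uniq by blast
qed

end

theory Submission
  imports Defs
begin

text \<open>By Knuth's theorem a permutation is \<open>\<sigma>\<close>-sortable iff the output of the \<open>\<sigma>\<close>-stack avoids
  231. Let \<open>\<pi>\<close> be sortable with \<open>\<pi>\<^sub>1 < x < z\<close> for adjacent entries \<open>z x\<close>. The entry \<open>\<pi>\<^sub>1\<close> ends
  the output, so \<open>z\<close> must be popped before \<open>x\<close> is pushed. If \<open>y\<close> is the last entry popped before
  \<open>x\<close>, then \<open>x y s\<close> is an occurrence of \<open>\<sigma>\<close> for some \<open>s\<close> left on the stack, while \<open>y x s\<close> is a
  subsequence of the output. Avoidance of 231 forces every entry of \<open>s\<close> below \<open>x\<close>, and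
  \<open>y < x\<close> would make \<open>z y s\<close> an occurrence of \<open>\<sigma>\<close> inside the stack; hence
  \<open>\<sigma> = 12 \<ominus> \<beta>\<close>. Conversely, such a \<open>\<sigma>\<close> has \<open>\<sigma>\<^sup>R\<close> as a sortable permutation containing
  \<open>\<xi>\<close>, because the \<open>\<sigma>\<close>-stack sends it to \<open>\<sigma>\<close> with its first two entries interchanged.\<close>

declare One_nat_def [simp del]

section \<open>Order isomorphism and pattern containment\<close>

lemma order_iso_length: "order_iso xs ys \<Longrightarrow> length xs = length ys"
  by (simp add: order_iso_def)

lemma order_iso_Cons:
  "order_iso (x # xs) (y # ys) \<longleftrightarrow> order_iso xs ys \<and>
     (\<forall>i<length xs. (x < xs ! i \<longleftrightarrow> y < ys ! i) \<and> (xs ! i < x \<longleftrightarrow> ys ! i < y))"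
  unfolding order_iso_def by (auto simp: All_less_Suc2)

text \<open>Both \<open>x\<close> and \<open>z\<close> exceed all of \<open>ys\<close>, so they
  compare alike with each entry. This allows \<open>z\<close> to take the place of \<open>x\<close>
  in an occurrence.\<close>

lemma order_iso_replace_max:
  assumes "order_iso (x # ys) \<tau>" and "\<forall>c\<in>set ys. c < x" and "\<forall>c\<in>set ys. c < z"
  shows "order_iso (z # ys) \<tau>"
proof (cases \<tau>)
  case (Cons t \<tau>')
  have "(z < ys ! i \<longleftrightarrow> x < ys ! i) \<and> (ys ! i < z \<longleftrightarrow> ys ! i < x)" if "i < length ys" for i
    using assms(2,3) nth_mem[OF that] less_asym[of "ys ! i"] by blast
  then show ?thesis
    using assms(1) unfolding Cons order_iso_Cons by blast
qed (use assms(1) in \<open>simp add: order_iso_def\<close>)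

lemma order_iso_refl: "order_iso xs xs"
  by (simp add: order_iso_def)

lemma contains_mono: "contains xs \<tau> \<Longrightarrow> subseq xs ys \<Longrightarrow> contains ys \<tau>"
  unfolding contains_def using subseq_order.trans by blast

lemma contains_length: "contains xs \<tau> \<Longrightarrow> length \<tau> \<le> length xs"
  unfolding contains_def by (metis list_emb_length order_iso_length)

text \<open>The positions of an occurrence in \<open>ys\<close> select an order isomorphic
  subsequence of \<open>xs\<close>.\<close>

lemma contains_order_iso_trans:
  assumes "order_iso xs ys" and "contains ys \<tau>"
  shows "contains xs \<tau>"
proof -
  obtain zs where zs: "subseq zs ys" "order_iso zs \<tau>"
    using assms(2) by (auto simp: contains_def)
  obtain N where N: "zs = nths ys N"
    using zs(1) by (auto simp: subseq_conv_nths)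
  have "order_iso (nths xs N) (nths ys N)"
    using assms(1)
  proof (induction xs arbitrary: ys N)
    case (Cons x xs)
    then obtain y ys' where ys: "ys = y # ys'"
      by (cases ys) (auto simp: order_iso_def)
    have iso: "order_iso xs ys'"
      using Cons.prems by (simp add: ys order_iso_Cons)
    let ?M = "{j. Suc j \<in> N}"
    have IH: "order_iso (nths xs ?M) (nths ys' ?M)"
      by (rule Cons.IH[OF iso])
    \<comment> \<open>Comparisons with the head are stated for zipped pairs, because
      \<open>nths\<close> shifts positions but keeps corresponding entries paired.\<close>
    have eq: "\<forall>p\<in>set (zip xs ys'). (x < fst p \<longleftrightarrow> y < snd p) \<and> (fst p < x \<longleftrightarrow> snd p < y)"
      using Cons.prems by (auto simp: ys order_iso_Cons set_zip)
    have zip_nths: "set (zip (nths as M) (nths bs M)) \<subseteq> set (zip as bs)"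
      if "length as = length bs" for as bs :: "nat list" and M
      using that
    proof (induction as bs arbitrary: M rule: list_induct2)
      case (Cons a as b bs)
      show ?case using Cons.IH[of "{j. Suc j \<in> M}"] by (auto simp: nths_Cons)
    qed simp
    have "(x < nths xs ?M ! i \<longleftrightarrow> y < nths ys' ?M ! i) \<and>
          (nths xs ?M ! i < x \<longleftrightarrow> nths ys' ?M ! i < y)" if "i < length (nths xs ?M)" for i
    proof -
      have "(nths xs ?M ! i, nths ys' ?M ! i) \<in> set (zip (nths xs ?M) (nths ys' ?M))"
        using that order_iso_length[OF IH] by (auto simp: set_zip)
      then show ?thesis
        using eq zip_nths[OF order_iso_length[OF iso]] by fastforce
    qed
    then show ?case
      using IH by (simp add: ys nths_Cons order_iso_Cons)
  qed (simp add: order_iso_def)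
  moreover have "order_iso us ws" if "order_iso us vs" "order_iso vs ws" for us vs ws
    using that by (simp add: order_iso_def)
  moreover have "subseq (nths xs N) xs"
    by (auto simp: subseq_conv_nths)
  ultimately show ?thesis
    using zs(2) N unfolding contains_def by blast
qed

lemma order_iso_231:
  "order_iso ys [2, 3, 1] \<longleftrightarrow> (\<exists>a b c. ys = [a, b, c] \<and> c < a \<and> a < b)"
proof
  assume L: "order_iso ys [2, 3, 1]"
  then have "length ys = Suc (Suc (Suc 0))"
    by (simp add: order_iso_def)
  then obtain a b c where ys: "ys = [a, b, c]"
    by (auto simp: length_Suc_conv)
  then show "\<exists>a b c. ys = [a, b, c] \<and> c < a \<and> a < b"
    using L by (auto simp: order_iso_Cons All_less_Suc2)
qed (auto simp: order_iso_Cons All_less_Suc2 order_iso_refl)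

lemma contains_231:
  "contains w [2, 3, 1] \<longleftrightarrow> (\<exists>a b c. subseq [a, b, c] w \<and> c < a \<and> a < b)"
  unfolding contains_def order_iso_231 by blast

lemma order_iso_21:
  "order_iso ys [2, 1] \<longleftrightarrow> (\<exists>a b. ys = [a, b] \<and> b < a)"
proof
  assume L: "order_iso ys [2, 1]"
  then have "length ys = Suc (Suc 0)"
    by (simp add: order_iso_def)
  then obtain a b where ys: "ys = [a, b]"
    by (auto simp: length_Suc_conv)
  then show "\<exists>a b. ys = [a, b] \<and> b < a"
    using L by (auto simp: order_iso_Cons All_less_Suc2)
qed (auto simp: order_iso_Cons All_less_Suc2 order_iso_refl)

lemma contains_21:
  "contains w [2, 1] \<longleftrightarrow> \<not> sorted w"
proof -
  have "contains w [2, 1] \<longleftrightarrow> (\<exists>a b. subseq [a, b] w \<and> b < a)"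
    unfolding contains_def order_iso_21 by blast
  also have "\<dots> \<longleftrightarrow> \<not> sorted w"
  proof (induction w)
    case (Cons x w)
    have "(\<exists>a b. subseq [a, b] (x # w) \<and> b < a) \<longleftrightarrow>
        (\<exists>b\<in>set w. b < x) \<or> (\<exists>a b. subseq [a, b] w \<and> b < a)"
      by (metis subseq_Cons2_iff subseq_singleton_left subseq_Cons')
    then show ?case using Cons.IH by (auto simp: not_le)
  qed simp
  finally show ?thesis .
qed

section \<open>Contents and order of the output\<close>

lemma mset_stack_run: "mset (stack_run \<tau> st xs) = mset st + mset xs"
  by (induction \<tau> st xs rule: stack_run.induct) auto

text \<open>Entries leave the stack from the top only, so later pushes merely interleave other
  entries with them.\<close>

lemma subseq_stack_run: "subseq st (stack_run \<tau> st xs)"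
proof (induction \<tau> st xs rule: stack_run.induct)
  case (3 \<tau> y st x xs)
  then show ?case by (auto dest: subseq_Cons')
qed simp_all

lemma subseq_rev: "subseq xs ys \<Longrightarrow> subseq (rev xs) (rev ys)"
proof (induction ys arbitrary: xs)
  case (Cons y ys)
  then show ?case
    using Cons.IH[of xs] Cons.IH[of "tl xs"]
    by (cases xs) (auto split: if_splits intro: list_emb_append_mono subseq_rev_drop_many)
qed auto

section \<open>Knuth's theorem on the 21-stack\<close>

text \<open>This is the situation in which \<open>x\<close> forces the pop of \<open>y\<close>. A
  later entry \<open>c < y\<close> would give the 231 formed by \<open>y x c\<close>; if there is
  none, \<open>y\<close> takes part in no 231.\<close>

lemma avoids_231_min:
  assumes "sorted st" and "\<forall>c\<in>set st. y \<le> c" and "y < x"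
  shows "avoids (rev st @ y # x # xs) [2, 3, 1] \<longleftrightarrow>
    (\<forall>c\<in>set xs. y \<le> c) \<and> avoids (rev st @ x # xs) [2, 3, 1]"
proof (intro iffI conjI ballI)
  assume R: "avoids (rev st @ y # x # xs) [2, 3, 1]"
  show "y \<le> c" if "c \<in> set xs" for c
  proof (rule ccontr)
    assume "\<not> y \<le> c"
    have "subseq [y, x, c] (rev st @ y # x # xs)"
      using that by (intro list_emb_append2) (simp add: subseq_singleton_left)
    with \<open>\<not> y \<le> c\<close> \<open>y < x\<close> R show False
      unfolding contains_231 by (meson not_le)
  qed
  have "subseq (rev st @ x # xs) (rev st @ y # x # xs)"
    by (rule list_emb_append_mono[OF subseq_order.refl list_emb_Cons[OF subseq_order.refl]])
  from contains_mono[OF _ this] show "avoids (rev st @ x # xs) [2, 3, 1]"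
    using R by blast
next
  assume L: "(\<forall>c\<in>set xs. y \<le> c) \<and> avoids (rev st @ x # xs) [2, 3, 1]"
  show "avoids (rev st @ y # x # xs) [2, 3, 1]"
  proof
    assume "contains (rev st @ y # x # xs) [2, 3, 1]"
    then obtain a b c where abc: "subseq [a, b, c] (rev st @ y # x # xs)" "c < a" "a < b"
      unfolding contains_231 by blast
    obtain us vs where uv: "[a, b, c] = us @ vs" "subseq us (rev st)" "subseq vs (y # x # xs)"
      using abc(1) by (rule subseq_appendE)
    have "\<not> subseq vs (x # xs)"
    proof
      assume "subseq vs (x # xs)"
      with uv(1,2) have "subseq [a, b, c] (rev st @ x # xs)"
        by (simp add: list_emb_append_mono)
      then show False using L abc(2,3) unfolding contains_231 by blast
    qed
    then obtain vs' where vs: "vs = y # vs'" "subseq vs' (x # xs)"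
      using uv(3) by (cases vs) (auto split: if_splits)
    have ge: "\<forall>c\<in>set vs'. y \<le> c"
      using list_emb_set[OF vs(2)] L \<open>y < x\<close> by fastforce
    have ge': "\<forall>c\<in>set us. y \<le> c"
      using list_emb_set[OF uv(2)] assms(2) by fastforce
    \<comment> \<open>Here \<open>y\<close> plays the 2, the 3 or the 1. Nothing after it is
      smaller, nothing in \<open>st\<close> is smaller, and \<open>rev st\<close> has no
      ascent.\<close>
    consider "us = []" "a = y" "c \<in> set vs'" | "us = [a]" "b = y" | "us = [a, b]"
      using uv(1) vs(1) by (auto simp: Cons_eq_append_conv)
    then show False
    proof cases
      case 1
      then show False using ge abc by auto
    next
      case 2
      then show False using ge' abc by auto
    next
      case 3
      then have "subseq [b, a] st"
        using subseq_rev[OF uv(2)] by simp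
      then have "contains st [2, 1]"
        using abc(3) order_iso_21 unfolding contains_def by blast
      then show False using assms(1) by (simp add: contains_21)
    qed
  qed
qed

text \<open>Knuth's theorem, generalized to a nonempty stack for the induction: a sorted content
  \<open>st\<close> arises by reading \<open>rev st\<close> without any pop, so the state stands for
  the input \<open>rev st @ xs\<close>.\<close>

lemma sorted_stack_run_21:
  assumes "sorted st" and "distinct (st @ xs)"
  shows "sorted (stack_run [2, 1] st xs) \<longleftrightarrow> avoids (rev st @ xs) [2, 3, 1]"
proof -
  have "sorted (stack_run \<tau> st xs) \<longleftrightarrow> avoids (rev st @ xs) [2, 3, 1]" if "\<tau> = [2, 1]" for \<tau>
    using that assms
  proof (induction \<tau> st xs rule: stack_run.induct)
    case (1 \<tau> st)
    \<comment> \<open>The ascent of a 231 in \<open>rev st\<close> would be a descent in the sorted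
      stack.\<close>
    have "\<not> contains (rev st) [2, 3, 1]"
    proof
      assume "contains (rev st) [2, 3, 1]"
      then obtain a b c where *: "subseq [a, b, c] (rev st)" "c < a" "a < b"
        unfolding contains_231 by blast
      have "subseq [b, a] st"
        using subseq_rev[OF *(1)] by (auto intro: subseq_order.trans[of "[b, a]" "[c, b, a]"])
      then have "contains st [2, 1]"
        using *(3) order_iso_21 unfolding contains_def by blast
      then show False using "1.prems" by (simp add: contains_21)
    qed
    then show ?case using "1.prems" by simp
  next
    case (2 \<tau> x xs)
    then show ?case by simp
  next
    case (3 \<tau> y st x xs)
    show ?case
    proof (cases "avoids (x # y # st) \<tau>")
      case True
      then have "sorted (x # y # st)"
        using "3.prems"(1) by (simp only: contains_21 not_not)
      then show ?thesis
        using "3.IH"(1)[OF True] "3.prems" True by simp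
    next
      case False
      then have "y < x"
        using "3.prems" by (auto simp: contains_21)
      have IH: "sorted (stack_run \<tau> st (x # xs)) \<longleftrightarrow> avoids (rev st @ x # xs) [2, 3, 1]"
        using "3.IH"(2)[OF False] "3.prems" by simp
      have set: "set (stack_run \<tau> st (x # xs)) = set st \<union> set (x # xs)"
        using arg_cong[OF mset_stack_run[of \<tau> st "x # xs"], of set_mset] by simp
      have le: "\<forall>c\<in>set st. y \<le> c" and st: "sorted st"
        using "3.prems" by simp_all
      \<comment> \<open>Since \<open>y\<close> is output first, sortedness requires it to be a
        minimum of everything that follows.\<close>
      have "sorted (stack_run \<tau> (y # st) (x # xs)) \<longleftrightarrow>
          (\<forall>c\<in>set xs. y \<le> c) \<and> avoids (rev st @ x # xs) [2, 3, 1]"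
        using False \<open>y < x\<close> le IH set by auto
      then show ?thesis
        using avoids_231_min[OF st le \<open>y < x\<close>, of xs] by simp
    qed
  qed
  then show ?thesis by blast
qed

lemma Sym_n_iff: "\<pi> \<in> Sym_n n \<longleftrightarrow> distinct \<pi> \<and> set \<pi> = {1..n} \<and> length \<pi> = n"
proof -
  have "length \<pi> = n" if "distinct \<pi>" "set \<pi> = {1..n}"
    using distinct_card[OF that(1)] unfolding that(2) by simp
  then show ?thesis
    unfolding Sym_n_def permutations_of_set_def by blast
qed

lemma Sym_iff: "\<pi> \<in> Sym \<longleftrightarrow> distinct \<pi> \<and> set \<pi> = {1..length \<pi>} \<and> \<pi> \<noteq> []"
proof -
  have "\<pi> \<in> Sym \<longleftrightarrow> \<pi> \<in> Sym_n (length \<pi>) \<and> length \<pi> \<ge> 1"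
    unfolding Sym_def by (auto simp: Sym_n_iff)
  also have "\<dots> \<longleftrightarrow> distinct \<pi> \<and> set \<pi> = {1..length \<pi>} \<and> \<pi> \<noteq> []"
    by (cases \<pi>) (simp_all add: Sym_n_iff)
  finally show ?thesis .
qed

text \<open>The final output rearranges \<open>1, ..., n\<close>, so it is the identity exactly when
  it is sorted; Knuth's theorem then applies to the intermediate word.\<close>

lemma Sort_iff: "\<pi> \<in> Sort \<sigma> \<longleftrightarrow> \<pi> \<in> Sym \<and> avoids (stack_op \<sigma> \<pi>) [2, 3, 1]"
proof (cases "\<pi> \<in> Sym")
  case True
  let ?w = "stack_op \<sigma> \<pi>" and ?v = "stack_op [2, 1] (stack_op \<sigma> \<pi>)"
  have m: "mset ?w = mset \<pi>" "mset ?v = mset \<pi>"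
    by (simp_all add: stack_op_def mset_stack_run)
  then have d: "distinct ?w" "distinct ?v" and s: "set ?v = set \<pi>"
    using True by (auto simp: Sym_iff dest: mset_eq_imp_distinct_iff mset_eq_setD)
  have "?v = [1..<length \<pi> + 1] \<longleftrightarrow> sorted ?v"
  proof
    assume "sorted ?v"
    then show "?v = [1..<length \<pi> + 1]"
      using s True
      by (intro sorted_distinct_set_unique[OF _ d(2) sorted_upt distinct_upt])
        (auto simp: Sym_iff simp del: upt_Suc)
  next
    assume "?v = [1..<length \<pi> + 1]"
    then show "sorted ?v" by (simp only: sorted_upt)
  qed
  also have "\<dots> \<longleftrightarrow> avoids ?w [2, 3, 1]"
    using sorted_stack_run_21[of "[]" ?w] d by (simp add: stack_op_def)
  finally show ?thesis using True by (simp add: Sort_def)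
qed (simp add: Sort_def)

section \<open>Following a run of the stack with a general pattern\<close>

text \<open>Isolates the pops made before \<open>x\<close> is pushed: \<open>p\<close> leaves and
  \<open>r\<close> stays. The last of these pops was forced by an occurrence in
  \<open>x # last p # r\<close>.\<close>

lemma stack_run_push_next:
  assumes "length \<tau> \<ge> 2"
  obtains p r where "st = p @ r" "stack_run \<tau> st (x # xs) = p @ stack_run \<tau> (x # r) xs"
    "avoids (x # r) \<tau>" "p \<noteq> [] \<Longrightarrow> contains (x # last p # r) \<tau>"
proof -
  have "\<exists>p r. st = p @ r \<and> stack_run \<tau> st (x # xs) = p @ stack_run \<tau> (x # r) xs \<and>
    avoids (x # r) \<tau> \<and> (p \<noteq> [] \<longrightarrow> contains (x # last p # r) \<tau>)"
  proof (induction st)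
    case Nil
    show ?case using assms contains_length[of "[x]" \<tau>] by auto
  next
    case (Cons y st)
    show ?case
    proof (cases "avoids (x # y # st) \<tau>")
      case True
      then show ?thesis by (intro exI[of _ "[]"] exI[of _ "y # st"]) auto
    next
      case False
      obtain p r where pr: "st = p @ r" "stack_run \<tau> st (x # xs) = p @ stack_run \<tau> (x # r) xs"
        "avoids (x # r) \<tau>" "p \<noteq> [] \<Longrightarrow> contains (x # last p # r) \<tau>"
        using Cons.IH by blast
      then show ?thesis using False
        by (intro exI[of _ "y # p"] exI[of _ r]) auto
    qed
  qed
  then show ?thesis using that by blast
qed

text \<open>The bottom entry is never popped before the input ends: above it alone, a push gives two
  entries, too few for a pattern of length at least three.\<close>

lemma stack_run_reach:
  assumes "length \<tau> \<ge> 3" and "st \<noteq> []"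
  obtains out st' where "stack_run \<tau> st (xs @ z # ys) = out @ stack_run \<tau> (z # st') ys"
    "avoids (z # st') \<tau>" "st' \<noteq> []" "last st' = last st"
proof -
  have "\<exists>out st'. stack_run \<tau> st (xs @ z # ys) = out @ stack_run \<tau> (z # st') ys \<and>
    avoids (z # st') \<tau> \<and> st' \<noteq> [] \<and> last st' = last st"
    using assms(2)
  proof (induction xs arbitrary: st)
    case Nil
    obtain p r where pr: "st = p @ r" "stack_run \<tau> st (z # ys) = p @ stack_run \<tau> (z # r) ys"
      "avoids (z # r) \<tau>" "p \<noteq> [] \<Longrightarrow> contains (z # last p # r) \<tau>"
      using stack_run_push_next[of \<tau> st z ys] assms(1) by auto
    have "r \<noteq> []"
      using pr(1,4) Nil assms(1) contains_length[of "z # last p # r" \<tau>] by auto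
    then show ?case using pr by auto
  next
    case (Cons x xs)
    obtain p r where pr: "st = p @ r"
      "stack_run \<tau> st (x # xs @ z # ys) = p @ stack_run \<tau> (x # r) (xs @ z # ys)"
      "avoids (x # r) \<tau>" "p \<noteq> [] \<Longrightarrow> contains (x # last p # r) \<tau>"
      using stack_run_push_next[of \<tau> st x "xs @ z # ys"] assms(1) by auto
    have "r \<noteq> []"
      using pr(1,4) Cons.prems assms(1) contains_length[of "x # last p # r" \<tau>] by auto
    moreover obtain out st' where
      "stack_run \<tau> (x # r) (xs @ z # ys) = out @ stack_run \<tau> (z # st') ys"
      "avoids (z # st') \<tau>" "st' \<noteq> []" "last st' = last (x # r)"
      using Cons.IH[of "x # r"] by auto
    ultimately show ?case using pr(1,2)
      by (intro exI[of _ "p @ out"] exI[of _ st']) simp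
  qed
  then show ?thesis using that by blast
qed

section \<open>Occurrences of \<xi> and skew sums with first summand 12\<close>

text \<open>Turns the index into a factorization, along which a run of the stack can be cut.\<close>

lemma contains_xi_iff:
  "contains_xi w \<longleftrightarrow> (\<exists>p u z x v. w = p # u @ z # x # v \<and> p < x \<and> x < z)"
proof
  assume "contains_xi w"
  then obtain j where j: "j \<ge> 1" "j + 1 < length w" "w ! 0 < w ! (j + 1)" "w ! (j + 1) < w ! j"
    by (auto simp: contains_xi_def)
  obtain i where i: "j = Suc i" using j(1) by (cases j) auto
  obtain p w' where w: "w = p # w'" using j(2) by (cases w) auto
  have "w' = take i w' @ w' ! i # w' ! Suc i # drop (Suc (Suc i)) w'"
    using j(2) i w by (simp add: Cons_nth_drop_Suc)
  then show "\<exists>p u z x v. w = p # u @ z # x # v \<and> p < x \<and> x < z"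
    using j w i by (intro exI[of _ p] exI[of _ "take i w'"] exI[of _ "w' ! i"]
        exI[of _ "w' ! Suc i"] exI[of _ "drop (Suc (Suc i)) w'"]) (simp add: One_nat_def)
next
  assume "\<exists>p u z x v. w = p # u @ z # x # v \<and> p < x \<and> x < z"
  then obtain p u z x v where "w = p # u @ z # x # v" "p < x" "x < z" by blast
  then show "contains_xi w"
    unfolding contains_xi_def
    by (intro exI[of _ "Suc (length u)"]) (simp add: nth_append One_nat_def)
qed

text \<open>The entries \<open>a\<close> and \<open>b\<close> must be the two largest values,
  \<open>k - 1\<close> and \<open>k\<close>.\<close>

lemma skew_sum_12I:
  assumes "a # b # \<beta> \<in> Sym_n k" and "a < b" and "\<forall>c\<in>set \<beta>. c < a"
  shows "a # b # \<beta> = [1, 2] \<ominus> \<beta>"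
proof -
  have s: "set (a # b # \<beta>) = {1..k}" and l: "k = length \<beta> + 2"
    using assms(1) by (auto simp: Sym_n_iff)
  have "b \<in> {1..k}" "a \<in> {1..k}"
    unfolding s[symmetric] by simp_all
  have "k \<in> set (a # b # \<beta>)" "k - 1 \<in> set (a # b # \<beta>)"
    unfolding s using l by auto
  then have "b = k" "a = k - 1"
    using assms(2,3) \<open>b \<in> {1..k}\<close> \<open>a \<in> {1..k}\<close> by fastforce+
  then show ?thesis by (simp add: skew_sum_def l)
qed

text \<open>Removing the two largest values leaves an initial interval; \<open>k \<ge> 3\<close>
  makes it nonempty, as \<open>Sym\<close> excludes the empty permutation.\<close>

lemma Sym_skew_12D:
  assumes "[1, 2] \<ominus> \<beta> \<in> Sym_n k" and "k \<ge> 3"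
  shows "\<beta> \<in> Sym"
proof -
  let ?n = "length \<beta>"
  have d: "distinct \<beta>" "1 + ?n \<notin> set \<beta>" "2 + ?n \<notin> set \<beta>" and k: "k = 2 + ?n"
    and s: "insert (1 + ?n) (insert (2 + ?n) (set \<beta>)) = {1..k}"
    using assms by (auto simp: Sym_n_iff skew_sum_def)
  have "set \<beta> = {1..k} - {1 + ?n, 2 + ?n}"
    unfolding s[symmetric] using d by blast
  also have "\<dots> = {1..?n}"
    unfolding k by auto
  finally show ?thesis
    using d(1) k assms(2) unfolding Sym_iff by fastforce
qed

section \<open>From a sortable permutation containing \<xi> to the form of \<sigma>\<close>

lemma skew_12_of_sortable:
  assumes \<sigma>: "\<sigma> \<in> Sym_n k" and k: "k \<ge> 3"
    and \<pi>: "\<pi> \<in> Sort \<sigma>" and xi: "contains_xi \<pi>"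
  shows "\<exists>\<beta> \<in> Sym_avoiding [2, 3, 1]. \<sigma> = [1, 2] \<ominus> \<beta>"
proof -
  have av: "avoids (stack_op \<sigma> \<pi>) [2, 3, 1]" and dp: "distinct \<pi>"
    using \<pi> by (auto simp: Sort_iff Sym_iff)
  have len: "length \<sigma> \<ge> 3" using \<sigma> k by (simp add: Sym_n_iff)
  obtain m u z x v where eq: "\<pi> = m # u @ z # x # v" and "m < x" "x < z"
    using xi by (auto simp: contains_xi_iff)
  \<comment> \<open>The run is cut when \<open>z\<close> has just been pushed; the first input entry
    \<open>m\<close> is still at the bottom.\<close>
  obtain out st where st: "stack_run \<sigma> [m] (u @ z # x # v) = out @ stack_run \<sigma> (z # st) (x # v)"
    "avoids (z # st) \<sigma>" "st \<noteq> []" "last st = m"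
    using stack_run_reach[OF len, of "[m]" u z "x # v"] by auto
  obtain p r where pr: "z # st = p @ r"
    "stack_run \<sigma> (z # st) (x # v) = p @ stack_run \<sigma> (x # r) v"
    "avoids (x # r) \<sigma>" "p \<noteq> [] \<Longrightarrow> contains (x # last p # r) \<sigma>"
    using stack_run_push_next[of \<sigma> "z # st" x v] len by auto
  have out: "stack_op \<sigma> \<pi> = out @ p @ stack_run \<sigma> (x # r) v"
    by (simp only: stack_op_def eq stack_run.simps(2) st(1) pr(2))
  have dist: "distinct (out @ p @ stack_run \<sigma> (x # r) v)"
    unfolding out[symmetric] using dp
    by (metis stack_op_def mset_stack_run mset.simps(1) add_0 mset_eq_imp_distinct_iff)
  \<comment> \<open>The entries of \<open>p\<close> are popped before \<open>x\<close> is pushed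
    onto \<open>r\<close>, and \<open>x # r\<close> later leaves from top to bottom.\<close>
  have sub: "subseq (p @ x # r) (stack_op \<sigma> \<pi>)"
    unfolding out by (intro list_emb_append2 list_emb_append_mono subseq_stack_run) simp
  have "mset (stack_run \<sigma> (x # r) v) = mset (x # r @ v)"
    by (simp add: mset_stack_run)
  then have dpx: "distinct (p @ x # r)"
    using dist mset_eq_imp_distinct_iff[of "stack_run \<sigma> (x # r) v" "x # r @ v"]
      mset_eq_setD[of "stack_run \<sigma> (x # r) v" "x # r @ v"] by auto
  have r: "r \<noteq> []"
    using pr(1,4) len contains_length[of "x # last p # r" \<sigma>] by auto
  have last: "last r = m"
    using pr(1) r st(3,4) by (metis last.simps last_append)
  text \<open>The first entry of the input stays at the bottom of the stack, so it supplies the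
    smallest entry of a 231 in the output.\<close>
  have small: "c < x" if c: "c \<in> set r" for c
  proof (rule ccontr)
    assume "\<not> c < x"
    then have "x < c" using c dpx by (auto simp: less_le)
    then have "c \<noteq> m" using \<open>m < x\<close> by auto
    then have "c \<in> set (butlast r)"
      using c last r by (metis append_butlast_last_id in_set_conv_decomp_last set_ConsD
          Un_iff empty_iff list.set(1) list.set(2) insert_iff set_append)
    then have "subseq ([c] @ [m]) (butlast r @ [last r])"
      using last by (intro list_emb_append_mono) (auto simp: subseq_singleton_left)
    then have "subseq ([] @ x # [c, m]) (p @ x # r)"
      using r by (intro list_emb_append_mono) auto
    then have "subseq [x, c, m] (stack_op \<sigma> \<pi>)"
      using subseq_order.trans[OF _ sub] by simp
    then show False using av \<open>x < c\<close> \<open>m < x\<close> unfolding contains_231 by blast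
  qed
  have p: "p \<noteq> []"
  proof
    assume "p = []"
    then have "z \<in> set r" using pr(1) by (metis append_Nil list.set_intros(1))
    then show False using small[of z] \<open>x < z\<close> by simp
  qed
  obtain p' y where p': "p = p' @ [y]"
    using p by (metis append_butlast_last_id)
  obtain ys where ys: "subseq ys (x # y # r)" "order_iso ys \<sigma>"
    using pr(4)[OF p] p' by (auto simp: contains_def)
  \<comment> \<open>The occurrence uses both top entries: without \<open>y\<close> it would lie in
    the new content \<open>x # r\<close>, without \<open>x\<close> in the old content
    \<open>z # st\<close>, and both avoid \<open>\<sigma>\<close>.\<close>
  have n1: "\<not> subseq ys (x # r)"
    using pr(3) ys(2) by (auto simp: contains_def)
  have n2: "\<not> subseq ys (y # r)"
  proof
    assume "subseq ys (y # r)"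
    then have "subseq ys (z # st)"
      unfolding pr(1) p' by (simp add: list_emb_append2)
    then show False using st(2) ys(2) by (auto simp: contains_def)
  qed
  obtain s where s: "ys = x # y # s" "subseq s r"
  proof -
    obtain ys' where 1: "ys = x # ys'" "subseq ys' (y # r)"
      using ys(1) n2 by (cases ys) (auto split: if_splits)
    then obtain s where "ys' = y # s" "subseq s r"
      using n1 by (cases ys') (auto split: if_splits)
    then show ?thesis using that 1 by blast
  qed
  have s_small: "c < x" if "c \<in> set s" for c
    using small s(2) that by (auto dest: list_emb_set)
  obtain a b \<beta> where ab: "\<sigma> = a # b # \<beta>"
    using len by (metis Suc_le_length_iff numeral_3_eq_3)
  have iso: "order_iso (x # y # s) (a # b # \<beta>)"
    using ys(2) s(1) ab by simp
  have lens: "length s = length \<beta>"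
    using order_iso_length[OF iso] by simp
  have "x < y"
  proof (rule ccontr)
    assume "\<not> x < y"
    moreover have "x \<noteq> y" using dpx p' by auto
    ultimately have "y < x" by simp
    \<comment> \<open>As \<open>y < x < z\<close>, the entry \<open>y\<close> is not
      \<open>z\<close>, so \<open>z\<close> lies strictly above it in the old stack. There
      \<open>z\<close> can replace \<open>x\<close>, which is now the maximum of the
      occurrence.\<close>
    then have "p' \<noteq> []" using pr(1) p' \<open>x < z\<close> by auto
    then obtain q where q: "p' = z # q"
      using pr(1) p' by (cases p') auto
    have x_max: "\<forall>c\<in>set (y # s). c < x"
      using s_small \<open>y < x\<close> by auto
    then have "\<forall>c\<in>set (y # s). c < z"
      using \<open>x < z\<close> less_trans by blast
    then have "order_iso (z # y # s) \<sigma>"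
      using order_iso_replace_max iso x_max unfolding ab by blast
    moreover have "subseq (z # y # s) (z # st)"
      unfolding pr(1) p' q using s(2) by (simp add: list_emb_append2)
    ultimately show False using st(2) by (auto simp: contains_def)
  qed
  have "a < b"
    using iso \<open>x < y\<close> by (auto simp: order_iso_Cons)
  moreover have "\<forall>c\<in>set \<beta>. c < a"
    using iso s_small lens by (fastforce simp: order_iso_Cons in_set_conv_nth)
  ultimately have eq\<sigma>: "\<sigma> = [1, 2] \<ominus> \<beta>"
    using \<sigma> ab skew_sum_12I by simp
  \<comment> \<open>The output contains \<open>s\<close>, an order isomorphic copy of
    \<open>\<beta>\<close>.\<close>
  have "\<not> contains \<beta> [2, 3, 1]"
  proof
    assume "contains \<beta> [2, 3, 1]"
    then have "contains s [2, 3, 1]"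
      using iso by (intro contains_order_iso_trans[of s \<beta>]) (auto simp: order_iso_Cons)
    moreover have "subseq s (stack_op \<sigma> \<pi>)"
      by (rule subseq_order.trans[OF _ sub]) (rule list_emb_append2[OF list_emb_Cons[OF s(2)]])
    ultimately show False
      using av contains_mono[of s] by blast
  qed
  then show ?thesis
    using eq\<sigma> Sym_skew_12D \<sigma> k unfolding Sym_avoiding_def by blast
qed

section \<open>The reversal of \<sigma> as input\<close>

text \<open>With fewer entries in total than \<open>\<tau>\<close> has, no push is ever
  blocked.\<close>

lemma stack_run_short:
  "length st + length xs < length \<tau> \<Longrightarrow> stack_run \<tau> st xs = rev xs @ st"
proof (induction \<tau> st xs rule: stack_run.induct)
  case (3 \<tau> y st x xs)
  then have "avoids (x # y # st) \<tau>"
    using contains_length[of "x # y # st" \<tau>] by auto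
  then show ?case using 3 by simp
qed simp_all

lemma stack_run_append_short:
  "length st + length xs < length \<tau> \<Longrightarrow> stack_run \<tau> st (xs @ ys) = stack_run \<tau> (rev xs @ st) ys"
proof (induction xs arbitrary: st)
  case (Cons x xs)
  have "stack_run \<tau> st (x # xs @ ys) = stack_run \<tau> (x # st) (xs @ ys)"
    using Cons.prems contains_length[of "x # st" \<tau>] by (cases st) auto
  then show ?case using Cons by simp
qed simp

text \<open>All entries but the first of \<open>\<sigma>\<close> pile up in the order of
  \<open>\<sigma>\<close>. The first one would complete \<open>\<sigma>\<close>, so the second is
  popped; then too few entries remain to block the push.\<close>

lemma stack_op_rev: "length \<sigma> \<ge> 3 \<Longrightarrow> stack_op \<sigma> (rev \<sigma>) = swap_first_two \<sigma>"
proof -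
  assume len: "length \<sigma> \<ge> 3"
  then obtain a b c t where \<sigma>: "\<sigma> = a # b # c # t"
    by (metis Suc_le_length_iff numeral_3_eq_3)
  have "stack_op \<sigma> (rev \<sigma>) = stack_run \<sigma> (b # c # t) [a]"
    using stack_run_append_short[of "[]" "rev (b # c # t)" \<sigma> "[a]"] by (simp add: stack_op_def \<sigma>)
  also have "\<dots> = b # stack_run \<sigma> (c # t) [a]"
    using order_iso_refl[of \<sigma>] by (auto simp: \<sigma> contains_def)
  also have "\<dots> = b # a # c # t"
    using stack_run_short[of "c # t" "[a]" \<sigma>] by (simp add: \<sigma>)
  finally show ?thesis by (simp add: \<sigma>)
qed

section \<open>Equivalence of the two descriptions of \<sigma>\<close>

lemma skew_12_iff:
  assumes "\<sigma> \<in> Sym_n k" and "k \<ge> 3"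
  shows "(\<exists>\<beta> \<in> Sym_avoiding [2, 3, 1]. \<sigma> = [1, 2] \<ominus> \<beta>) \<longleftrightarrow>
     swap_first_two \<sigma> \<in> Sym_avoiding [2, 3, 1] \<and> contains_xi (rev \<sigma>)"
proof
  assume "\<exists>\<beta> \<in> Sym_avoiding [2, 3, 1]. \<sigma> = [1, 2] \<ominus> \<beta>"
  then obtain \<beta> where \<beta>: "\<beta> \<in> Sym" "avoids \<beta> [2, 3, 1]" and eq: "\<sigma> = [1, 2] \<ominus> \<beta>"
    by (auto simp: Sym_avoiding_def)
  have set: "set \<beta> = {1..length \<beta>}" using \<beta> by (simp add: Sym_iff)
  let ?n = "length \<beta>"
  have sw: "swap_first_two \<sigma> = (2 + ?n) # (1 + ?n) # \<beta>"
    by (simp add: eq skew_sum_def)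
  have "\<not> contains (swap_first_two \<sigma>) [2, 3, 1]"
  proof
    assume "contains (swap_first_two \<sigma>) [2, 3, 1]"
    then obtain a b c where abc: "subseq [a, b, c] (swap_first_two \<sigma>)" "c < a" "a < b"
      unfolding contains_231 by blast
    \<comment> \<open>The two large leading entries are excluded in turn: \<open>b\<close> lies
      behind the first entry, so \<open>a < b < 2 + ?n\<close> and \<open>a\<close> is not first. If
      \<open>a\<close> were \<open>1 + ?n\<close>, then \<open>b\<close> would lie in
      \<open>\<beta>\<close> and be smaller.\<close>
    have le: "b \<le> ?n" if "subseq [b, c] \<beta>"
      using list_emb_set[OF that, of b] set by auto
    have "b < 2 + ?n"
      using abc(1) le set unfolding sw
      by (auto split: if_splits dest: subseq_Cons' list_emb_set)
    then have "subseq [a, b, c] ((1 + ?n) # \<beta>)"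
      using abc(1,3) unfolding sw by (simp split: if_splits)
    then have "subseq [a, b, c] \<beta>"
      using le abc(3) by (simp split: if_splits)
    then show False using abc(2,3) \<beta>(2) unfolding contains_231 by blast
  qed
  moreover have "swap_first_two \<sigma> \<in> Sym"
  proof -
    have "insert (2 + ?n) (insert (1 + ?n) {1..?n}) = {1..2 + ?n}"
      by auto
    moreover have "distinct (swap_first_two \<sigma>)"
      using \<beta>(1) unfolding sw by (simp add: Sym_iff)
    ultimately show ?thesis
      using set unfolding sw Sym_iff by simp
  qed
  moreover have "contains_xi (rev \<sigma>)"
  proof -
    have "\<beta> \<noteq> []" using \<beta>(1) by (simp add: Sym_iff)
    \<comment> \<open>The last entry \<open>p\<close> of \<open>\<beta>\<close> starts
      \<open>rev \<sigma>\<close>, and the two largest values, in decreasing order, end it.\<close>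
    then obtain \<beta>' p where "\<beta> = \<beta>' @ [p]" by (metis rev_exhaust)
    moreover have "p \<le> length \<beta>" using set calculation by auto
    ultimately have "rev \<sigma> = p # rev \<beta>' @ (2 + ?n) # (1 + ?n) # [] \<and> p < 1 + ?n \<and> 1 + ?n < 2 + ?n"
      by (simp add: eq skew_sum_def)
    then show ?thesis unfolding contains_xi_iff by blast
  qed
  ultimately show "swap_first_two \<sigma> \<in> Sym_avoiding [2, 3, 1] \<and> contains_xi (rev \<sigma>)"
    by (simp add: Sym_avoiding_def)
next
  assume R: "swap_first_two \<sigma> \<in> Sym_avoiding [2, 3, 1] \<and> contains_xi (rev \<sigma>)"
  then have av: "avoids (swap_first_two \<sigma>) [2, 3, 1]" by (simp add: Sym_avoiding_def)
  obtain p u z x v where w: "rev \<sigma> = p # u @ z # x # v" "p < x" "x < z"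
    using R by (auto simp: contains_xi_iff)
  have \<sigma>: "\<sigma> = rev v @ x # z # rev u @ [p]"
    using arg_cong[OF w(1), of rev] by simp
  have no: "\<not> subseq [x, z, p] (swap_first_two \<sigma>)"
    using av w unfolding contains_231 by blast
  have zp: "subseq [z, p] (z # rev u @ [p])"
    by (simp add: list_emb_append2)
  \<comment> \<open>If anything preceded \<open>x z\<close> in \<open>\<sigma>\<close>, the swap
    would act before \<open>x\<close> or move only \<open>x\<close> forward, and
    \<open>x z p\<close> would survive as a 231.\<close>
  have "v = []"
  proof (cases "rev v" rule: swap_first_two.cases)
    case (1 a b v')
    then have "swap_first_two \<sigma> = (b # a # v') @ x # z # rev u @ [p]"
      using \<sigma> by simp
    moreover have "subseq [x, z, p] (x # z # rev u @ [p])"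
      using zp by simp
    ultimately have "subseq [x, z, p] (swap_first_two \<sigma>)"
      using list_emb_append2 by metis
    then show ?thesis using no by blast
  next
    case ("2_1")
    then show ?thesis by simp
  next
    case ("2_2" a)
    then have "swap_first_two \<sigma> = x # a # z # rev u @ [p]"
      using \<sigma> by simp
    moreover have "subseq [x, z, p] (x # a # z # rev u @ [p])"
      using list_emb_Cons[OF zp] unfolding subseq_Cons2_iff by simp
    ultimately show ?thesis using no by metis
  qed
  then have \<sigma>': "\<sigma> = x # z # rev u @ [p]" using \<sigma> by simp
  \<comment> \<open>An entry above \<open>x\<close> is not \<open>p\<close>, so it lies between
    \<open>x\<close> and \<open>p\<close> and forms a 231 with them, untouched by the swap.\<close>
  have "c < x" if c: "c \<in> set (rev u @ [p])" for c
  proof (rule ccontr)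
    assume "\<not> c < x"
    moreover have "x \<noteq> c"
      using c assms(1) unfolding \<sigma>' Sym_n_iff by force
    ultimately have "x < c" by simp
    then have "c \<in> set (rev u)" using c w(2) by auto
    then have "subseq ([c] @ [p]) (rev u @ [p])"
      by (intro list_emb_append_mono) (auto simp: subseq_singleton_left)
    then have "subseq [x, c, p] (x # rev u @ [p])"
      by simp
    from list_emb_Cons[OF this] have "subseq [x, c, p] (swap_first_two \<sigma>)"
      unfolding \<sigma>' swap_first_two.simps .
    then show False using av \<open>x < c\<close> w unfolding contains_231 by blast
  qed
  then have lt: "\<forall>c\<in>set (rev u @ [p]). c < x" by blast
  have eq: "\<sigma> = [1, 2] \<ominus> (rev u @ [p])"
    using skew_sum_12I[OF assms(1)[unfolded \<sigma>'] w(3) lt] \<sigma>' by (rule trans[rotated])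
  moreover have "subseq (rev u @ [p]) (swap_first_two \<sigma>)"
    unfolding \<sigma>' swap_first_two.simps by (intro list_emb_Cons subseq_order.refl)
  from contains_mono[OF _ this] have "avoids (rev u @ [p]) [2, 3, 1]"
    using av by blast
  moreover have "rev u @ [p] \<in> Sym"
    using Sym_skew_12D assms eq by blast
  ultimately show "\<exists>\<beta> \<in> Sym_avoiding [2, 3, 1]. \<sigma> = [1, 2] \<ominus> \<beta>"
    unfolding Sym_avoiding_def by blast
qed

theorem theorem6:
  fixes \<sigma> :: "nat list" and k :: nat
  assumes "k \<ge> 3" and "\<sigma> \<in> Sym_n k"
  shows "(\<not> Sort \<sigma> \<subseteq> Sym_avoiding_xi \<longleftrightarrow>
            (\<exists>\<beta> \<in> Sym_avoiding [2, 3, 1]. \<sigma> = [1, 2] \<ominus> \<beta>))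
       \<and> ((\<exists>\<beta> \<in> Sym_avoiding [2, 3, 1]. \<sigma> = [1, 2] \<ominus> \<beta>) \<longleftrightarrow>
            swap_first_two \<sigma> \<in> Sym_avoiding [2, 3, 1] \<and> contains_xi (rev \<sigma>))"
proof (intro conjI skew_12_iff[OF assms(2,1)] iffI)
  assume "\<not> Sort \<sigma> \<subseteq> Sym_avoiding_xi"
  then obtain \<pi> where "\<pi> \<in> Sort \<sigma>" "contains_xi \<pi>"
    unfolding Sym_avoiding_xi_def using Sort_iff by blast
  then show "\<exists>\<beta> \<in> Sym_avoiding [2, 3, 1]. \<sigma> = [1, 2] \<ominus> \<beta>"
    using skew_12_of_sortable assms by blast
next
  assume "\<exists>\<beta> \<in> Sym_avoiding [2, 3, 1]. \<sigma> = [1, 2] \<ominus> \<beta>"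
  then have "swap_first_two \<sigma> \<in> Sym_avoiding [2, 3, 1]" and xi: "contains_xi (rev \<sigma>)"
    using skew_12_iff[OF assms(2,1)] by blast+
  \<comment> \<open>The witness is \<open>rev \<sigma>\<close>: its image under the
    \<open>\<sigma>\<close>-stack is \<open>swap_first_two \<sigma>\<close>.\<close>
  then have "avoids (stack_op \<sigma> (rev \<sigma>)) [2, 3, 1]"
    using assms stack_op_rev[of \<sigma>] by (simp add: Sym_avoiding_def Sym_n_iff)
  moreover have "rev \<sigma> \<in> Sym"
    using assms by (auto simp: Sym_n_iff Sym_iff)
  ultimately show "\<not> Sort \<sigma> \<subseteq> Sym_avoiding_xi"
    using xi by (auto simp: Sort_iff Sym_avoiding_xi_def)
qed

end
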